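(* Let $0<p<1$ and let $\{G_n : n\ge 1\}$ be the Superstar model with parameter $p$, with superstar vertex $v_0$. Then, with probability one, $$\lim_{n\to\infty}\frac1n\deg(v_0,G_n)=p .$$
   Context: Superstar model with parameter $p\in(0,1)$: a growing sequence of random trees $G_1,G_2,\dots$ constructed sequentially on one probability space. $G_1$ is the single vertex $v_0$ (the superstar). $G_2$ consists of $v_0$, a vertex $v_1$ and the edge between them. For $n\ge 2$, given $G_n$ (with vertex set $\{v_0,\dots,v_{n-1}\}$), $G_{n+1}$ is obtained by adding a new vertex $v_n$ and one edge: with probability $p$ the vertex $v_n$ is joined to $v_0$; with probability $1-p$ it is joined to one of the nonsuperstars $v_1,\dots,v_{n-1}$, where $v_i$ is chosen with probability proportional to its degree in $G_n$. $\deg(v,G)$ denotes the degree of vertex $v$ in the graph $G$. *)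

theory Defs
  imports "HOL-Probability.Probability"
begin

text \<open>
  Undirected graphs whose vertices are natural numbers; the number \<open>i\<close> stands for
  the vertex \<open>v\<^sub>i\<close>, so that \<open>0\<close> is the superstar. An edge is the two-element set of its endpoints.
\<close>

datatype graph = Graph (verts: "nat set") (edges: "nat set set")

definition graphs_on :: "nat set \<Rightarrow> graph set" where
  "graphs_on V = {g. verts g = V \<and> edges g \<subseteq> {{u, v} | u v. u \<in> V \<and> v \<in> V \<and> u \<noteq> v}}"

definition deg :: "nat \<Rightarrow> graph \<Rightarrow> nat" where
  "deg v g = card {e \<in> edges g. v \<in> e}"

definition add_leaf :: "nat \<Rightarrow> nat \<Rightarrow> graph \<Rightarrow> graph" where
  "add_leaf w u g = Graph (insert w (verts g)) (insert {u, w} (edges g))"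

text \<open>
  The random graph \<open>G n\<close> is indexed from \<open>n = 1\<close> on (\<open>G 0\<close> is unconstrained). Its state space is
  the finite set of all graphs on \<open>{0,\<dots>,n-1}\<close>; that \<open>G n\<close> is almost surely a tree extending
  \<open>G (n - 1)\<close> is a consequence of the transition probabilities, because given \<open>G n\<close> these sum
  to 1 over all attachment points. For the same reason \<open>G n\<close> almost surely determines
  \<open>G 1, \<dots>, G (n - 1)\<close>, so conditioning on \<open>G n\<close> is the same as conditioning on the whole past.
\<close>

locale superstar_model = prob_space M
  for M :: "'a measure" and p :: real and G :: "nat \<Rightarrow> 'a \<Rightarrow> graph" +
  assumes random_graph: "\<And>n. n \<ge> 1 \<Longrightarrow> G n \<in> M \<rightarrow>\<^sub>M count_space (graphs_on {..<n})"
    and G_1: "\<And>\<omega>. \<omega> \<in> space M \<Longrightarrow> G 1 \<omega> = Graph {0} {}"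
    and G_2: "\<And>\<omega>. \<omega> \<in> space M \<Longrightarrow> G 2 \<omega> = Graph {0, 1} {{0, 1}}"
    and attach_superstar:
      "\<And>n g. n \<ge> 2 \<Longrightarrow> \<P>(\<omega> in M. G n \<omega> = g) > 0 \<Longrightarrow>
        \<P>(\<omega> in M. G (n + 1) \<omega> = add_leaf n 0 g \<bar> G n \<omega> = g) = p"
    and attach_nonsuperstar:
      "\<And>n g i. n \<ge> 2 \<Longrightarrow> \<P>(\<omega> in M. G n \<omega> = g) > 0 \<Longrightarrow> i \<in> {1..n - 1} \<Longrightarrow>
        \<P>(\<omega> in M. G (n + 1) \<omega> = add_leaf n i g \<bar> G n \<omega> = g) =
          (1 - p) * (real (deg i g) / (\<Sum>j = 1..n - 1. real (deg j g)))"

end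

theory Submission imports Defs "HOL-Real_Asymp.Real_Asymp" begin

text \<open>
  Given a tree on \<open>n\<close> vertices, the attachment probabilities sum to 1, so almost surely
  the superstar gains an edge with conditional probability \<open>p\<close> and otherwise keeps its degree.
  Hence the degree of the superstar in \<open>G (n + 2)\<close>, less 1, is binomially distributed with
  parameters \<open>n\<close> and \<open>p\<close>, and Hoeffding's inequality together with Borel--Cantelli gives the almost sure limit.
\<close>

section \<open>Finite graphs and the attachment of a leaf\<close>

lemma finite_graphs_on:
  assumes "finite V"
  shows "finite (graphs_on V)"
proof (rule finite_subset)
  show "graphs_on V \<subseteq> (\<lambda>E. Graph V E) ` Pow (Pow V)"
  proof
    fix g assume "g \<in> graphs_on V"
    then show "g \<in> (\<lambda>E. Graph V E) ` Pow (Pow V)"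
      by (cases g) (auto simp: graphs_on_def)
  qed
  show "finite ((\<lambda>E. Graph V E) ` Pow (Pow V))"
    using assms by simp
qed

lemma finite_edges:
  assumes "g \<in> graphs_on V" "finite V"
  shows "finite (edges g)"
proof (rule finite_subset)
  show "edges g \<subseteq> Pow V"
    using assms(1) by (fastforce simp: graphs_on_def)
qed (use assms in simp)

text \<open>All edges of \<open>g\<close> lie inside \<open>V\<close>, so none contains
  \<open>w\<close>. This makes \<open>add_leaf\<close> a genuine insertion, on which injectivity and
  the degree count rest.\<close>

lemma new_edge_notin:
  assumes "g \<in> graphs_on V" "w \<notin> V"
  shows "{u, w} \<notin> edges g"
proof
  assume "{u, w} \<in> edges g"
  then obtain a b where "{u, w} = {a, b}" "a \<in> V" "b \<in> V"
    using assms(1) unfolding graphs_on_def by blast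
  then show False
    using assms(2) by (auto simp: doubleton_eq_iff)
qed

text \<open>Makes the attachment events disjoint, so that their probabilities add up, and lets the
  attachment point be read off from the new graph.\<close>

lemma add_leaf_inject:
  assumes "g \<in> graphs_on V" "w \<notin> V" "add_leaf w u g = add_leaf w u' g"
  shows "u = u'"
proof -
  have "insert {u, w} (edges g) = insert {u', w} (edges g)"
    using assms(3) by (simp add: add_leaf_def)
  then have "{u, w} = {u', w}"
    using new_edge_notin[OF assms(1,2)] by blast
  then show ?thesis
    by (auto simp: doubleton_eq_iff)
qed

lemma deg_add_leaf:
  assumes "g \<in> graphs_on V" "finite V" "w \<notin> V" "v \<noteq> w"
  shows "deg v (add_leaf w u g) = (if u = v then Suc (deg v g) else deg v g)"
proof -
  have "{e \<in> insert {u, w} (edges g). v \<in> e} =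
      (if u = v then insert {u, w} {e \<in> edges g. v \<in> e} else {e \<in> edges g. v \<in> e})"
    using assms(4) by auto
  then show ?thesis
    using new_edge_notin[OF assms(1,3)] finite_edges[OF assms(1,2)]
    by (simp add: deg_def add_leaf_def)
qed

lemma deg_superstar_single_edge: "deg 0 (Graph V {{0, i}}) = 1"
proof -
  have "{e \<in> {{0, i}}. 0 \<in> e} = {{0, i}}"
    by auto
  then show ?thesis
    by (simp add: deg_def)
qed

text \<open>This sum is the denominator of the attachment probabilities. If it vanished, division by
  zero would yield 0 and these probabilities would sum to \<open>p\<close> only. The edge between 0
  and 1 gives vertex 1 positive degree.\<close>

lemma sum_deg_pos:
  assumes "g \<in> graphs_on {..<n}" "n \<ge> 2" "{0, 1} \<in> edges g"
  shows "(\<Sum>j = 1..n - 1. real (deg j g)) > 0"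
proof -
  have "{e \<in> edges g. 1 \<in> e} \<noteq> {}"
    using assms(3) by blast
  then have "deg 1 g > 0"
    using finite_edges[OF assms(1)] by (simp add: deg_def card_gt_0_iff)
  then show ?thesis
    using assms(2) by (intro sum_pos2[where i = 1]) auto
qed

section \<open>Binomial laws: recursion, deviations and almost sure limit\<close>

text \<open>Conditioning on the last trial. The superstar degree obeys the same recursion.\<close>

lemma pmf_binomial_Suc:
  assumes "p \<in> {0..1}"
  shows "pmf (binomial_pmf (Suc n) p) k =
    (if k = 0 then 0 else p * pmf (binomial_pmf n p) (k - 1)) + (1 - p) * pmf (binomial_pmf n p) k"
proof (cases k)
  case 0
  then show ?thesis
    using assms by simp
next
  case (Suc j)
  \<comment> \<open>For \<open>j < n\<close> one factor \<open>1 - p\<close> splits off. For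
    \<open>j \<ge> n\<close>, where the subtraction is truncated, the binomial coefficient is
    0.\<close>
  have *: "(1 - p) ^ (n - j) * real (n choose Suc j) =
      (1 - p) * (1 - p) ^ (n - Suc j) * real (n choose Suc j)"
  proof (cases "j < n")
    case True
    then have "n - j = Suc (n - Suc j)"
      by simp
    then show ?thesis
      by simp
  qed simp
  then show ?thesis
    using assms Suc arg_cong[OF *, of "(*) (p ^ Suc j)"] by (simp add: algebra_simps)
qed

context prob_space
begin

text \<open>The point masses determine the law of \<open>X\<close> on the countable space of
  naturals, so Hoeffding's inequality carries over from the binomial distribution.\<close>

lemma prob_binomial_deviation:
  assumes X: "X \<in> M \<rightarrow>\<^sub>M count_space UNIV"
    and p: "p \<in> {0..1}"
    and pmf: "\<And>k. \<P>(\<omega> in M. X \<omega> = k) = pmf (binomial_pmf n p) k"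
    and "n > 0" "\<epsilon> \<ge> 0"
  shows "\<P>(\<omega> in M. \<bar>real (X \<omega>) / n - p\<bar> \<ge> \<epsilon>) \<le> 2 * exp (-2 * n * \<epsilon>\<^sup>2)"
proof -
  interpret B: binomial_distribution n p
    by unfold_locales (rule p)
  have "distr M (count_space UNIV) X = measure_pmf (binomial_pmf n p)"
  proof (rule measure_eqI_countable[where A = UNIV])
    fix k :: nat
    have "emeasure (distr M (count_space UNIV) X) {k} = emeasure M {\<omega> \<in> space M. X \<omega> = k}"
      using X by (subst emeasure_distr) (auto intro!: arg_cong[where f = "emeasure M"])
    then show "emeasure (distr M (count_space UNIV) X) {k} = emeasure (measure_pmf (binomial_pmf n p)) {k}"
      using pmf[of k] by (simp add: emeasure_eq_measure emeasure_pmf_single)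
  qed auto
  then have "measure_pmf.prob (binomial_pmf n p) {x. \<bar>real x / n - p\<bar> \<ge> \<epsilon>} =
      measure (distr M (count_space UNIV) X) {x. \<bar>real x / n - p\<bar> \<ge> \<epsilon>}"
    by simp
  also have "\<dots> = \<P>(\<omega> in M. \<bar>real (X \<omega>) / n - p\<bar> \<ge> \<epsilon>)"
    using X by (subst measure_distr) (auto intro!: arg_cong[where f = "measure M"])
  finally show ?thesis
    using B.prob_abs_ge'[OF \<open>n > 0\<close> \<open>\<epsilon> \<ge> 0\<close>] by simp
qed

text \<open>
  Only the marginal laws matter: the Hoeffding bounds are summable, so Borel--Cantelli applies
  whatever the joint law is.
\<close>

lemma binomial_strong_law:
  assumes X: "\<And>n. X n \<in> M \<rightarrow>\<^sub>M count_space UNIV"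
    and p: "p \<in> {0..1}"
    and pmf: "\<And>n k. \<P>(\<omega> in M. X n \<omega> = k) = pmf (binomial_pmf n p) k"
  shows "AE \<omega> in M. (\<lambda>n. real (X n \<omega>) / n) \<longlonglongrightarrow> p"
proof -
  note [measurable] = X
  have "AE \<omega> in M. \<forall>\<^sub>F n in sequentially. \<bar>real (X n \<omega>) / n - p\<bar> < \<epsilon>" if "\<epsilon> > 0" for \<epsilon> :: real
  proof -
    let ?A = "\<lambda>n. {\<omega> \<in> space M. \<bar>real (X n \<omega>) / n - p\<bar> \<ge> \<epsilon>}"
    have "summable (\<lambda>n. prob (?A n))"
    proof (rule summable_comparison_test')
      \<comment> \<open>The Hoeffding bounds form a geometric series of ratio below 1.\<close>
      have "summable (\<lambda>n. 2 * exp (-2 * \<epsilon>\<^sup>2) ^ n)"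
        using \<open>\<epsilon> > 0\<close> by (intro summable_mult summable_geometric) simp
      then show "summable (\<lambda>n. 2 * exp (-2 * n * \<epsilon>\<^sup>2))"
        by (simp add: exp_of_nat_mult[symmetric] mult_ac)
      show "norm (prob (?A n)) \<le> 2 * exp (-2 * n * \<epsilon>\<^sup>2)" if "n \<ge> 1" for n
        using prob_binomial_deviation[OF X p pmf] that \<open>\<epsilon> > 0\<close> by simp
    qed
    then have "AE \<omega> in M. \<forall>\<^sub>F n in sequentially. \<omega> \<in> space M - ?A n"
      by (intro borel_cantelli_AE1) (auto simp: emeasure_eq_measure)
    then show ?thesis
      by (rule AE_mp) (auto intro!: AE_I2 elim!: eventually_mono)
  qed
  \<comment> \<open>Only countably many tolerances are used, so that the union of the exceptional
    null sets is again null.\<close>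
  then have "AE \<omega> in M. \<forall>j. \<forall>\<^sub>F n in sequentially. \<bar>real (X n \<omega>) / n - p\<bar> < 1 / real (Suc j)"
    by (subst AE_all_countable) simp
  then show ?thesis
  proof (rule AE_mp, intro AE_I2 impI)
    fix \<omega>
    assume *: "\<forall>j. \<forall>\<^sub>F n in sequentially. \<bar>real (X n \<omega>) / n - p\<bar> < 1 / real (Suc j)"
    show "(\<lambda>n. real (X n \<omega>) / n) \<longlonglongrightarrow> p"
    proof (rule tendstoI)
      fix e :: real assume "e > 0"
      then obtain j where "1 / real (Suc j) < e"
        using nat_approx_posE by blast
      then show "\<forall>\<^sub>F n in sequentially. dist (real (X n \<omega>) / n) p < e"
        using *[rule_format, of j] by (auto simp: dist_real_def elim!: eventually_mono)
    qed
  qed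
qed

end

section \<open>Almost sure structure of the attachment step\<close>

context superstar_model
begin

lemma G_in_graphs_on: "n \<ge> 1 \<Longrightarrow> \<omega> \<in> space M \<Longrightarrow> G n \<omega> \<in> graphs_on {..<n}"
  using measurable_space[OF random_graph] by simp

text \<open>Both state spaces are finite, so their product carries the discrete sigma-algebra and
  every predicate of two consecutive graphs defines an event.\<close>

lemma events_G:
  assumes "n \<ge> 1"
  shows "{\<omega> \<in> space M. Q (G n \<omega>) (G (Suc n) \<omega>)} \<in> events"
proof -
  let ?N = "count_space (graphs_on {..<n} \<times> graphs_on {..<Suc n})"
  have "(\<lambda>\<omega>. (G n \<omega>, G (Suc n) \<omega>)) \<in>
      M \<rightarrow>\<^sub>M count_space (graphs_on {..<n}) \<Otimes>\<^sub>M count_space (graphs_on {..<Suc n})"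
    using random_graph assms by (intro measurable_Pair) auto
  then have "(\<lambda>\<omega>. (G n \<omega>, G (Suc n) \<omega>)) \<in> M \<rightarrow>\<^sub>M ?N"
    by (simp add: pair_measure_countable finite_graphs_on countable_finite)
  then have "Measurable.pred M (\<lambda>\<omega>. case_prod Q (G n \<omega>, G (Suc n) \<omega>))"
    by (rule measurable_compose) simp
  then show ?thesis
    by (simp add: pred_def)
qed

text \<open>The attachment events for \<open>i < n\<close> are disjoint and their probabilities sum
  to that of \<open>G n = g\<close>, so what they leave of this event is a null set.\<close>

lemma AE_attach_given:
  assumes n: "n \<ge> 2"
    and pos: "\<P>(\<omega> in M. G n \<omega> = g) > 0"
    and edge: "{0, 1} \<in> edges g"
  shows "AE \<omega> in M. G n \<omega> = g \<longrightarrow> (\<exists>i<n. G (Suc n) \<omega> = add_leaf n i g)"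
proof -
  let ?E = "{\<omega> \<in> space M. G n \<omega> = g}"
  let ?B = "\<lambda>i. {\<omega> \<in> space M. G (Suc n) \<omega> = add_leaf n i g \<and> G n \<omega> = g}"
  have E: "?E \<in> events" and B: "\<And>i. ?B i \<in> events"
    using n events_G[of n "\<lambda>x y. x = g"] events_G[of n "\<lambda>x y. y = add_leaf n i g \<and> x = g" for i]
    by auto
  \<comment> \<open>Positive probability means that \<open>g\<close> is a value of
    \<open>G n\<close>, which places it in the state space.\<close>
  have "?E \<noteq> {}"
    using pos by (metis less_irrefl measure_empty)
  then have g: "g \<in> graphs_on {..<n}"
    using G_in_graphs_on[of n] n by auto
  have B0: "prob (?B 0) = p * prob ?E"
    using attach_superstar[OF n pos] pos by (simp add: cond_prob_def field_simps)
  define S where "S = (\<Sum>j = 1..n - 1. real (deg j g))"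
  have "S > 0"
    unfolding S_def by (rule sum_deg_pos[OF g n edge])
  have Bi: "prob (?B i) = (1 - p) * (real (deg i g) / S) * prob ?E" if "i \<in> {1..n - 1}" for i
    using attach_nonsuperstar[OF n pos that] pos unfolding S_def[symmetric]
    by (simp add: cond_prob_def divide_eq_eq)
  have "prob (\<Union>i<n. ?B i) = (\<Sum>i<n. prob (?B i))"
  proof (rule finite_measure_finite_Union)
    show "disjoint_family_on ?B {..<n}"
      using add_leaf_inject[OF g] by (fastforce simp: disjoint_family_on_def)
  qed (use B in auto)
  also have "\<dots> = (\<Sum>i\<in>insert 0 {1..n - 1}. prob (?B i))"
    using n by (intro sum.cong) auto
  also have "\<dots> = p * prob ?E + (\<Sum>i = 1..n - 1. prob (?B i))"
    using B0 by simp
  also have "(\<Sum>i = 1..n - 1. prob (?B i)) = (\<Sum>i = 1..n - 1. real (deg i g)) * ((1 - p) / S * prob ?E)"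
    unfolding sum_distrib_right by (intro sum.cong refl) (simp only: Bi, simp)
  \<comment> \<open>The degree sum cancels against \<open>S\<close>, which is nonzero.\<close>
  also have "\<dots> = (1 - p) * prob ?E"
    using \<open>S > 0\<close> unfolding S_def[symmetric] by simp
  finally have "prob (\<Union>i<n. ?B i) = prob ?E"
    by (simp add: algebra_simps)
  moreover have "prob (?E - (\<Union>i<n. ?B i)) = prob ?E - prob (\<Union>i<n. ?B i)"
    by (rule finite_measure_Diff) (use E B in auto)
  ultimately have "emeasure M (?E - (\<Union>i<n. ?B i)) = 0"
    by (simp add: emeasure_eq_measure)
  then show ?thesis
    by (intro AE_I[where N = "?E - (\<Union>i<n. ?B i)"]) (use E B in auto)
qed

lemma AE_attach_if_AE_edge:
  assumes n: "n \<ge> 2"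
    and edge: "AE \<omega> in M. {0, 1} \<in> edges (G n \<omega>)"
  shows "AE \<omega> in M. \<exists>i<n. G (Suc n) \<omega> = add_leaf n i (G n \<omega>)"
proof -
  have "AE \<omega> in M. G n \<omega> = g \<longrightarrow> (\<exists>i<n. G (Suc n) \<omega> = add_leaf n i g)" for g
  proof (cases "\<P>(\<omega> in M. G n \<omega> = g) > 0")
    case pos: True
    \<comment> \<open>An almost sure property of \<open>G n\<close> holds for every graph that
      \<open>G n\<close> attains with positive probability.\<close>
    have "{0, 1} \<in> edges g"
    proof (rule ccontr)
      assume "{0, 1} \<notin> edges g"
      then have "AE \<omega> in M. G n \<omega> \<noteq> g"
        using edge by (auto elim!: AE_mp)
      then show False
        using pos prob_eq_0_AE by force
    qed
    then show ?thesis
      by (rule AE_attach_given[OF n pos])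
  next
    case False
    then have "prob {\<omega> \<in> space M. G n \<omega> = g} = 0"
      by (simp add: zero_less_measure_iff)
    then have "AE \<omega> in M. G n \<omega> \<noteq> g"
      using prob_Collect_eq_0[of "\<lambda>\<omega>. G n \<omega> = g"] events_G[of n "\<lambda>x y. x = g"] n by auto
    then show ?thesis
      by eventually_elim simp
  qed
  \<comment> \<open>With finitely many graphs, one null set serves all of them, and \<open>g\<close>
    can then be taken to be the random graph \<open>G n \<omega>\<close> itself.\<close>
  then have "AE \<omega> in M. \<forall>g\<in>graphs_on {..<n}. G n \<omega> = g \<longrightarrow> (\<exists>i<n. G (Suc n) \<omega> = add_leaf n i g)"
    by (intro AE_finite_allI finite_graphs_on) auto
  then show ?thesis
    by (rule AE_mp) (use G_in_graphs_on n in \<open>auto intro!: AE_I2\<close>)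
qed

text \<open>Edges are never removed by an attachment. The preceding lemma supplies the attachment in
  the induction step, and in return loses its hypothesis on the edge.\<close>

lemma AE_edge:
  assumes "n \<ge> 2"
  shows "AE \<omega> in M. {0, 1} \<in> edges (G n \<omega>)"
  using assms
proof (induction n rule: nat_induct_at_least)
  case base
  show ?case
    by (intro AE_I2) (simp add: G_2)
next
  case (Suc n)
  from AE_attach_if_AE_edge[OF Suc.hyps Suc.IH] Suc.IH show ?case
    by eventually_elim (auto simp: add_leaf_def)
qed

lemmas AE_attach = AE_attach_if_AE_edge[OF _ AE_edge]

section \<open>Law of the superstar degree\<close>

text \<open>The model has no variable for the chosen vertex, so the choice is expressed through two
  consecutive graphs.\<close>

definition to_superstar :: "nat \<Rightarrow> 'a \<Rightarrow> bool" where
  "to_superstar n \<omega> \<longleftrightarrow> G (Suc n) \<omega> = add_leaf n 0 (G n \<omega>)"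

lemma AE_deg_superstar_Suc:
  assumes "n \<ge> 2"
  shows "AE \<omega> in M. deg 0 (G (Suc n) \<omega>) =
    (if to_superstar n \<omega> then Suc (deg 0 (G n \<omega>)) else deg 0 (G n \<omega>))"
  using AE_attach[OF assms assms]
proof (rule AE_mp, intro AE_I2 impI)
  fix \<omega> assume \<omega>: "\<omega> \<in> space M" and "\<exists>i<n. G (Suc n) \<omega> = add_leaf n i (G n \<omega>)"
  then obtain i where i: "i < n" "G (Suc n) \<omega> = add_leaf n i (G n \<omega>)"
    by blast
  have g: "G n \<omega> \<in> graphs_on {..<n}"
    using G_in_graphs_on \<omega> assms by simp
  have "to_superstar n \<omega> \<longleftrightarrow> i = 0"
    using add_leaf_inject[OF g, of n i 0] i by (auto simp: to_superstar_def)
  then show "deg 0 (G (Suc n) \<omega>) =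
      (if to_superstar n \<omega> then Suc (deg 0 (G n \<omega>)) else deg 0 (G n \<omega>))"
    using deg_add_leaf[OF g, of n 0 i] i assms by simp
qed

text \<open>Attachment to the superstar is independent of \<open>G n\<close>: its conditional
  probability is \<open>p\<close> whatever the graph, and summing over the graphs with property
  \<open>Q\<close> keeps this factor.\<close>

lemma prob_to_superstar:
  assumes n: "n \<ge> 2"
  shows "\<P>(\<omega> in M. to_superstar n \<omega> \<and> Q (G n \<omega>)) = p * \<P>(\<omega> in M. Q (G n \<omega>))"
proof -
  let ?K = "{g \<in> graphs_on {..<n}. Q g}"
  let ?A = "\<lambda>g. {\<omega> \<in> space M. to_superstar n \<omega> \<and> G n \<omega> = g}"
  let ?E = "\<lambda>g. {\<omega> \<in> space M. G n \<omega> = g}"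
  have fin: "finite ?K"
    by (simp add: finite_graphs_on)
  have E: "?E g \<in> events" and A: "?A g \<in> events" for g
    using n events_G[of n "\<lambda>x y. x = g"] events_G[of n "\<lambda>x y. y = add_leaf n 0 x \<and> x = g"]
    by (auto simp: to_superstar_def)
  \<comment> \<open>The model fixes the conditional probability only for graphs of positive
    probability; for the others both sides are 0.\<close>
  have *: "prob (?A g) = p * prob (?E g)" for g
  proof (cases "prob (?E g) > 0")
    case True
    have "?A g = {\<omega> \<in> space M. G (Suc n) \<omega> = add_leaf n 0 g \<and> G n \<omega> = g}"
      by (auto simp: to_superstar_def)
    then show ?thesis
      using attach_superstar[OF n True] True by (simp add: cond_prob_def field_simps)
  next
    case False
    then have "prob (?E g) = 0"
      by (simp add: zero_less_measure_iff)
    moreover have "prob (?A g) \<le> prob (?E g)"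
      by (rule finite_measure_mono) (use E in auto)
    ultimately show ?thesis
      by (simp add: measure_le_0_iff)
  qed
  have "{\<omega> \<in> space M. to_superstar n \<omega> \<and> Q (G n \<omega>)} = (\<Union>g\<in>?K. ?A g)"
    using G_in_graphs_on n by auto
  then have "\<P>(\<omega> in M. to_superstar n \<omega> \<and> Q (G n \<omega>)) = (\<Sum>g\<in>?K. prob (?A g))"
    using finite_measure_finite_Union[OF fin, of ?A] A by (auto simp: disjoint_family_on_def)
  moreover have "{\<omega> \<in> space M. Q (G n \<omega>)} = (\<Union>g\<in>?K. ?E g)"
    using G_in_graphs_on n by auto
  then have "\<P>(\<omega> in M. Q (G n \<omega>)) = (\<Sum>g\<in>?K. prob (?E g))"
    using finite_measure_finite_Union[OF fin, of ?E] E by (auto simp: disjoint_family_on_def)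
  ultimately show ?thesis
    by (simp add: * sum_distrib_left)
qed

lemma prob_deg_superstar_Suc:
  assumes n: "n \<ge> 2"
  shows "\<P>(\<omega> in M. deg 0 (G (Suc n) \<omega>) = k) =
    (if k = 0 then 0 else p * \<P>(\<omega> in M. deg 0 (G n \<omega>) = k - 1)) +
    (1 - p) * \<P>(\<omega> in M. deg 0 (G n \<omega>) = k)"
proof -
  let ?D = "\<lambda>k. {\<omega> \<in> space M. deg 0 (G n \<omega>) = k}"
  let ?A = "\<lambda>k. {\<omega> \<in> space M. to_superstar n \<omega> \<and> deg 0 (G n \<omega>) = k}"
  \<comment> \<open>Written with \<open>Suc\<close>, the event is empty for \<open>k = 0\<close>;
    the truncated \<open>k - 1\<close> would wrongly admit degree 0.\<close>
  let ?U = "{\<omega> \<in> space M. to_superstar n \<omega> \<and> Suc (deg 0 (G n \<omega>)) = k}"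
  have ev: "?D k \<in> events" "?A k \<in> events" "?U \<in> events"
    "{\<omega> \<in> space M. deg 0 (G (Suc n) \<omega>) = k} \<in> events"
    using n events_G[of n "\<lambda>x y. deg 0 x = k"] events_G[of n "\<lambda>x y. y = add_leaf n 0 x \<and> deg 0 x = k"]
      events_G[of n "\<lambda>x y. y = add_leaf n 0 x \<and> Suc (deg 0 x) = k"] events_G[of n "\<lambda>x y. deg 0 y = k"]
    by (auto simp: to_superstar_def)
  have A: "prob (?A j) = p * prob (?D j)" for j
    by (rule prob_to_superstar[OF n])
  have "prob ?U = (if k = 0 then 0 else p * prob (?D (k - 1)))"
  proof (cases k)
    case (Suc j)
    then show ?thesis
      using A[of j] by simp
  qed simp
  moreover have "prob (?D k - ?A k) = (1 - p) * prob (?D k)"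
    using finite_measure_Diff[of "?D k" "?A k"] ev A[of k] by (auto simp: algebra_simps)
  \<comment> \<open>Up to a null set, degree \<open>k\<close> arises either by a gain from
    \<open>k - 1\<close> or by staying at \<open>k\<close>.\<close>
  moreover have "prob {\<omega> \<in> space M. deg 0 (G (Suc n) \<omega>) = k} = prob (?U \<union> (?D k - ?A k))"
  proof (rule finite_measure_eq_AE)
    show "AE \<omega> in M. \<omega> \<in> {\<omega> \<in> space M. deg 0 (G (Suc n) \<omega>) = k} \<longleftrightarrow> \<omega> \<in> ?U \<union> (?D k - ?A k)"
      using AE_deg_superstar_Suc[OF n] by eventually_elim auto
  qed (use ev in auto)
  moreover have "\<dots> = prob ?U + prob (?D k - ?A k)"
    by (rule finite_measure_Union) (use ev in auto)
  ultimately show ?thesis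
    by simp
qed

text \<open>Both sides satisfy the same recursion in \<open>n\<close>. It starts at
  \<open>G 2\<close>, where degree 1 corresponds to no successes in no trials.\<close>

lemma prob_deg_superstar:
  assumes p: "p \<in> {0..1}"
  shows "\<P>(\<omega> in M. deg 0 (G (n + 2) \<omega>) = k) =
    (if k = 0 then 0 else pmf (binomial_pmf n p) (k - 1))"
proof (induction n arbitrary: k)
  case 0
  have "{\<omega> \<in> space M. deg 0 (G 2 \<omega>) = k} = (if k = 1 then space M else {})"
    using G_2 by (auto simp: deg_superstar_single_edge)
  then have "\<P>(\<omega> in M. deg 0 (G (0 + 2) \<omega>) = k) = (if k = 1 then 1 else 0)"
    unfolding add_0 by (simp add: prob_space)
  then show ?case
    using p by (auto simp: binomial_pmf_0 indicator_def simp del: pmf_binomial)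
next
  case (Suc n)
  show ?case
    using prob_deg_superstar_Suc[of "n + 2" k] Suc.IH pmf_binomial_Suc[OF p, of n "k - 1"]
    by (auto simp del: pmf_binomial)
qed

text \<open>Truncated subtraction sends the degrees 0 and 1 both to 0, but degree 0 has probability
  0.\<close>

lemma prob_deg_superstar_minus_1:
  assumes p: "p \<in> {0..1}"
  shows "\<P>(\<omega> in M. deg 0 (G (n + 2) \<omega>) - 1 = k) = pmf (binomial_pmf n p) k"
proof -
  let ?D = "\<lambda>k. {\<omega> \<in> space M. deg 0 (G (n + 2) \<omega>) = k}"
  have D: "?D k \<in> events" for k
    using events_G[of "n + 2" "\<lambda>x y. deg 0 x = k"] by simp
  have "prob (?D 0) = 0"
    using prob_deg_superstar[OF p, of n 0] by simp
  then have "AE \<omega> in M. deg 0 (G (n + 2) \<omega>) \<noteq> 0"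
    using prob_Collect_eq_0[OF D[of 0]] by simp
  then have "AE \<omega> in M. \<omega> \<in> {\<omega> \<in> space M. deg 0 (G (n + 2) \<omega>) - 1 = k} \<longleftrightarrow> \<omega> \<in> ?D (Suc k)"
    by eventually_elim auto
  then have "\<P>(\<omega> in M. deg 0 (G (n + 2) \<omega>) - 1 = k) = prob (?D (Suc k))"
    using D events_G[of "n + 2" "\<lambda>x y. deg 0 x - 1 = k"] by (intro finite_measure_eq_AE) auto
  then show ?thesis
    using prob_deg_superstar[OF p, of n "Suc k"] by simp
qed

lemma AE_deg_superstar_minus_1:
  assumes p: "p \<in> {0..1}"
  shows "AE \<omega> in M. (\<lambda>n. real (deg 0 (G (n + 2) \<omega>) - 1) / n) \<longlonglongrightarrow> p"
proof (rule binomial_strong_law[OF _ p prob_deg_superstar_minus_1[OF p]])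
  show "(\<lambda>\<omega>. deg 0 (G (n + 2) \<omega>) - 1) \<in> M \<rightarrow>\<^sub>M count_space UNIV" for n
    by (rule measurable_compose[OF random_graph]) auto
qed

end

section \<open>From the binomial count to the degree ratio\<close>

lemma ratio_limit_shift:
  fixes d :: "nat \<Rightarrow> nat"
  assumes "(\<lambda>n. real (d (n + 2) - 1) / real n) \<longlonglongrightarrow> p"
  shows "(\<lambda>n. (1 / real n) * real (d n)) \<longlonglongrightarrow> p"
proof (rule LIMSEQ_offset[where k = 2])
  let ?a = "\<lambda>n. real (d (n + 2) - 1) / real n"
  have r: "(\<lambda>n. real n / real (n + 2)) \<longlonglongrightarrow> 1" "(\<lambda>n. 1 / real (n + 2)) \<longlonglongrightarrow> 0"
    by real_asymp+
  have 1: "(\<lambda>n. ?a n * (real n / real (n + 2))) \<longlonglongrightarrow> p"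
    using tendsto_mult[OF assms r(1)] by simp
  have 2: "(\<lambda>n. ?a n * (real n / real (n + 2)) + 1 / real (n + 2)) \<longlonglongrightarrow> p"
    using tendsto_add[OF 1 r(2)] by simp
  \<comment> \<open>At \<open>n = 0\<close> the left side is 0 by division by zero, so the equation
    is claimed only eventually.\<close>
  have a: "\<forall>\<^sub>F n in sequentially. ?a n * (real n / real (n + 2)) = real (d (n + 2) - 1) / real (n + 2)"
    using eventually_gt_at_top[of 0] by eventually_elim simp
  show "(\<lambda>n. (1 / real (n + 2)) * real (d (n + 2))) \<longlonglongrightarrow> p"
  \<comment> \<open>Truncated or not, subtracting 1 lowers the degree by at most 1, an error of at
    most \<open>1 / (n + 2)\<close> in the ratio.\<close>
  proof (rule tendsto_sandwich[OF _ _ 1 2])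
    show "\<forall>\<^sub>F n in sequentially.
        ?a n * (real n / real (n + 2)) \<le> (1 / real (n + 2)) * real (d (n + 2))"
      using a by eventually_elim (simp add: divide_right_mono)
    show "\<forall>\<^sub>F n in sequentially.
        (1 / real (n + 2)) * real (d (n + 2)) \<le> ?a n * (real n / real (n + 2)) + 1 / real (n + 2)"
      using a by eventually_elim (simp add: add_divide_distrib[symmetric] divide_right_mono)
  qed
qed

theorem theorem2p1:
  fixes M :: "'a measure" and p :: real and G :: "nat \<Rightarrow> 'a \<Rightarrow> graph"
  assumes "0 < p" and "p < 1"
    and "superstar_model M p G"
  shows "AE \<omega> in M. (\<lambda>n. (1 / real n) * real (deg 0 (G n \<omega>))) \<longlonglongrightarrow> p"
proof -
  interpret superstar_model M p G
    by (rule assms(3))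
  have "AE \<omega> in M. (\<lambda>n. real (deg 0 (G (n + 2) \<omega>) - 1) / n) \<longlonglongrightarrow> p"
    using assms(1,2) by (intro AE_deg_superstar_minus_1) simp
  then show ?thesis
    by eventually_elim (rule ratio_limit_shift)
qed

end
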